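(* Let $n\ge 2$, $\tau\in\{1,\dots,n\}$, and let $f_1,\dots,f_n:\mathbb{R}^d\to\mathbb{R}$ be differentiable and convex, with $f_i$ being $L_i$-smooth, $L_i>0$; let $f=\frac1n\sum_{i=1}^n f_i$ be $\mu$-strongly convex with $\mu>0$, and $L_{\max}=\max_i L_i$. Suppose there is $x_\star\in\mathbb{R}^d$ with $\nabla f_i(x_\star)=0$ for all $i$ (interpolation regime). Let $0<\gamma<+\infty$, let $L_{\gamma}$ be the smoothness constant of $M^\gamma$, and let $$L_{\gamma,\tau}=\frac{n-\tau}{\tau(n-1)}\frac{L_{\max}}{1+\gamma L_{\max}}+\frac{n(\tau-1)}{\tau(n-1)}L_\gamma.$$ Run FedExProx with $\tau$-nice sampling, step size $\gamma$ and constant extrapolation parameter $\alpha_k=\alpha\in\left(0,\frac{2}{\gamma L_{\gamma,\tau}}\right)$ from $x_0\in\mathbb{R}^d$. Then the final iterate satisfies $$\mathbb{E}\left[\|x_K-x_\star\|^2\right]\le\left(1-\alpha\gamma(2-\alpha\gamma L_{\gamma,\tau})\cdot\frac{\mu}{2(1+\gamma L_{\max})}\right)^K\|x_0-x_\star\|^2.$$ For fixed $\gamma$ and $\tau$, the extrapolation parameter minimizing the convergence rate $1-\alpha\gamma(2-\alpha\gamma L_{\gamma,\tau})\frac{\mu}{2(1+\gamma L_{\max})}$ is $\alpha_{\gamma,\tau}=\frac1{\gamma L_{\gamma,\tau}}>1$, and with $\alpha=\alpha_{\gamma,\tau}$ $$\mathbb{E}\left[\|x_K-x_\star\|^2\right]\le\left(1-\frac{\mu}{2L_{\gamma,\tau}(1+\gamma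 L_{\max})}\right)^K\|x_0-x_\star\|^2.$$
   Context: $\|\cdot\|$ is the Euclidean norm. A differentiable $\phi:\mathbb{R}^d\to\mathbb{R}$ is $L$-smooth if $\phi(x)-\phi(y)-\langle\nabla\phi(y),x-y\rangle\le\frac L2\|x-y\|^2$ for all $x,y$, and $\mu$-strongly convex if $\phi(x)-\phi(y)-\langle\nabla\phi(y),x-y\rangle\ge\frac\mu2\|x-y\|^2$ for all $x,y$. Proximity operator: $\mathrm{prox}_{\gamma\phi}(x)=\arg\min_{z}\{\phi(z)+\frac1{2\gamma}\|z-x\|^2\}$. Moreau envelope: $M^\gamma_\phi(x)=\min_z\{\phi(z)+\frac1{2\gamma}\|z-x\|^2\}$. $M^\gamma=\frac1n\sum_{i=1}^n M^\gamma_{f_i}$. Convention on $L_\gamma$: $L_\gamma>0$, $M^\gamma$ is $L_\gamma$-smooth and $L_\gamma\le\frac1n\sum_{i=1}^n\frac{L_i}{1+\gamma L_i}$ (such a constant always exists). FedExProx with $\tau$-nice sampling: starting at $x_0$, at each iteration $k$ a set $S_k\subseteq\{1,\dots,n\}$ is sampled uniformly at random (independently of the past) among all subsets of cardinality $\tau$, and $x_{k+1}=x_k+\alpha_k\left(\frac1\tau\sum_{i\in S_k}\mathrm{prox}_{\gamma f_i}(x_k)-x_k\right)$. The expectation is over all the randomness. *)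

theory Defs
  imports "HOL-Probability.Probability"
begin

definition grad :: "('a::real_inner \<Rightarrow> real) \<Rightarrow> 'a \<Rightarrow> 'a" where
  "grad \<phi> x = (THE D. GDERIV \<phi> x :> D)"

definition smooth_with :: "real \<Rightarrow> ('a::real_inner \<Rightarrow> real) \<Rightarrow> bool" where
  "smooth_with L \<phi> \<longleftrightarrow> (\<forall>x. \<phi> differentiable (at x)) \<and>
     (\<forall>x y. \<phi> x - \<phi> y - grad \<phi> y \<bullet> (x - y) \<le> L / 2 * (norm (x - y))\<^sup>2)"

definition strongly_convex :: "real \<Rightarrow> ('a::real_inner \<Rightarrow> real) \<Rightarrow> bool" where
  "strongly_convex \<mu> \<phi> \<longleftrightarrow> (\<forall>x. \<phi> differentiable (at x)) \<and>
     (\<forall>x y. \<phi> x - \<phi> y - grad \<phi> y \<bullet> (x - y) \<ge> \<mu> / 2 * (norm (x - y))\<^sup>2)"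

definition prox :: "real \<Rightarrow> ('a::real_inner \<Rightarrow> real) \<Rightarrow> 'a \<Rightarrow> 'a" where
  "prox \<gamma> \<phi> x = (ARG_MIN (\<lambda>z. \<phi> z + 1 / (2 * \<gamma>) * (norm (z - x))\<^sup>2) z. True)"

(* The minimum is written as an infimum. For \<gamma> > 0 and continuous convex \<phi> on a
   finite-dimensional space it is attained, at prox \<gamma> \<phi> x. *)
definition moreau :: "real \<Rightarrow> ('a::real_inner \<Rightarrow> real) \<Rightarrow> 'a \<Rightarrow> real" where
  "moreau \<gamma> \<phi> x = (INF z. \<phi> z + 1 / (2 * \<gamma>) * (norm (z - x))\<^sup>2)"

definition avg_fun :: "nat \<Rightarrow> (nat \<Rightarrow> 'a \<Rightarrow> real) \<Rightarrow> 'a \<Rightarrow> real" where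
  "avg_fun n f x = 1 / real n * (\<Sum>i\<in>{1..n}. f i x)"

definition tau_subsets :: "nat \<Rightarrow> nat \<Rightarrow> nat set set" where
  "tau_subsets n \<tau> = {A. A \<subseteq> {1..n} \<and> card A = \<tau>}"

(* Mutual independence of the whole sequence is the same as independence of each S k
   from S 0, ..., S (k - 1). *)
definition nice_sampling ::
    "'w measure \<Rightarrow> nat \<Rightarrow> nat \<Rightarrow> (nat \<Rightarrow> 'w \<Rightarrow> nat set) \<Rightarrow> bool" where
  "nice_sampling P n \<tau> S \<longleftrightarrow>
     prob_space.indep_vars P (\<lambda>_. count_space (tau_subsets n \<tau>)) S UNIV \<and>
     (\<forall>k. distr P (count_space (tau_subsets n \<tau>)) (S k)
            = uniform_count_measure (tau_subsets n \<tau>))"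

(* The iterates for one realisation S 0, S 1, ... of the sampled sets. *)
primrec fedexprox :: "(nat \<Rightarrow> 'a::real_inner \<Rightarrow> real) \<Rightarrow> nat \<Rightarrow> real \<Rightarrow> (nat \<Rightarrow> real) \<Rightarrow> 'a
    \<Rightarrow> (nat \<Rightarrow> nat set) \<Rightarrow> nat \<Rightarrow> 'a" where
  "fedexprox f \<tau> \<gamma> \<alpha> x0 S 0 = x0"
| "fedexprox f \<tau> \<gamma> \<alpha> x0 S (Suc k) =
     (let x = fedexprox f \<tau> \<gamma> \<alpha> x0 S k
      in x + \<alpha> k *\<^sub>R ((1 / real \<tau>) *\<^sub>R (\<Sum>i\<in>S k. prox \<gamma> (f i) x) - x))"

end

theory Submission
  imports Defs
begin

text \<open>
  Put \<open>u\<^sub>i(x) = (x - prox \<gamma> f\<^sub>i x) / \<gamma>\<close>. This is a subgradient of the Moreau envelope of \<open>f\<^sub>i\<close>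
  at \<open>x\<close> and the gradient of \<open>f\<^sub>i\<close> at the prox point, and one iteration subtracts
  \<open>\<alpha> \<gamma>\<close> times the sample mean of the \<open>u\<^sub>i\<close>. Let \<open>q\<close> be the inner product of the full mean of
  the \<open>u\<^sub>i(x)\<close> with \<open>x - xstar\<close>. Cocoercivity of the \<open>f\<^sub>i\<close> bounds the mean of the
  \<open>\<parallel>u\<^sub>i\<parallel>\<^sup>2\<close> by \<open>Lmax / (1 + \<gamma> Lmax) q\<close>, cocoercivity of the averaged envelope
  bounds the squared norm of the mean by \<open>L\<gamma> q\<close>, and the second moment of a sample mean without
  replacement mixes both bounds into \<open>L\<gamma>\<tau> q\<close>. Hence a step decreases the expected squared
  distance by at least \<open>\<alpha> \<gamma> (2 - \<alpha> \<gamma> L\<gamma>\<tau>) q\<close>. Finally the envelope gap dominates the gap of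
  \<open>f\<^sub>i\<close> divided by \<open>1 + \<gamma> Lmax\<close>, so strong convexity bounds \<open>q\<close> from below.
\<close>

section \<open>Convex smooth functions, proximity operators and Moreau envelopes\<close>

text \<open>\<open>grad\<close> is a definite description, so existence and uniqueness must both be
  settled. The derivative is a linear functional, represented by its adjoint applied to 1;
  uniqueness of the derivative gives uniqueness of the representing vector.\<close>

lemma GDERIV_grad:
  fixes \<phi> :: "'a::euclidean_space \<Rightarrow> real"
  assumes "\<phi> differentiable (at x)"
  shows "GDERIV \<phi> x :> grad \<phi> x"
proof -
  obtain F where F: "(\<phi> has_derivative F) (at x)"
    using assms differentiable_def by blast
  then have "linear F"
    using has_derivative_linear by blast
  then have "F h = h \<bullet> adjoint F 1" for h
    using adjoint_works[of F h 1] by simp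
  with F have "GDERIV \<phi> x :> adjoint F 1"
    unfolding gderiv_def by (metis (no_types, lifting) ext)
  moreover have "D = D'" if "GDERIV \<phi> x :> D" "GDERIV \<phi> x :> D'" for D D'
  proof -
    have "(\<lambda>h. h \<bullet> D) = (\<lambda>h. h \<bullet> D')"
      using that has_derivative_unique unfolding gderiv_def by blast
    then show ?thesis
      by (metis vector_eq_ldot)
  qed
  ultimately show ?thesis
    unfolding grad_def by (metis theI)
qed

text \<open>Subtracting the affine minorant leaves a function minimal at \<open>x\<close>, whose
  derivative there vanishes. This identifies gradients at prox points and at minimizers from
  inequalities alone.\<close>

lemma grad_eq_subgradient:
  fixes \<phi> :: "'a::euclidean_space \<Rightarrow> real"
  assumes diff: "\<phi> differentiable (at x)"
    and sub: "\<And>y. \<phi> y \<ge> \<phi> x + u \<bullet> (y - x)"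
  shows "grad \<phi> x = u"
proof -
  have "((\<lambda>y. \<phi> y - u \<bullet> (y - x)) has_derivative (\<lambda>h. h \<bullet> grad \<phi> x - u \<bullet> h)) (at x)"
    using GDERIV_grad[OF diff] unfolding gderiv_def
    by (auto intro!: derivative_eq_intros)
  moreover have "\<forall>y\<in>UNIV. \<phi> x - u \<bullet> (x - x) \<le> \<phi> y - u \<bullet> (y - x)"
    using sub by (auto simp: algebra_simps)
  ultimately have "(\<lambda>h. h \<bullet> grad \<phi> x - u \<bullet> h) = (\<lambda>h. 0)"
    using differential_zero_maxmin[of x UNIV] by blast
  then have "h \<bullet> grad \<phi> x = h \<bullet> u" for h
    by (metis eq_iff_diff_eq_0 inner_commute)
  then show ?thesis
    by (metis vector_eq_ldot)
qed

text \<open>Restricting to the line through \<open>x\<close> and \<open>y\<close> reduces the claim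
  to the tangent inequality for a convex function of one real variable.\<close>

lemma convex_grad_zero_imp_minimum:
  fixes \<phi> :: "'a::euclidean_space \<Rightarrow> real"
  assumes convex: "convex_on UNIV \<phi>" and diff: "\<phi> differentiable (at x)"
    and grad: "grad \<phi> x = 0"
  shows "\<phi> x \<le> \<phi> y"
proof -
  let ?g = "\<lambda>t. \<phi> (x + t *\<^sub>R (y - x))"
  have "(\<phi> has_derivative (\<lambda>h. 0)) (at (x + 0 *\<^sub>R (y - x)))"
    using GDERIV_grad[OF diff] grad by (simp add: gderiv_def)
  then have "(?g has_derivative (\<lambda>h. 0)) (at 0)"
    by (rule has_derivative_compose[rotated]) (auto intro!: derivative_eq_intros)
  then have "(?g has_field_derivative 0) (at 0)"
    by (simp add: has_field_derivative_def lambda_zero)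
  moreover have "convex_on UNIV ?g"
  proof (rule convex_onI)
    fix t a b :: real assume "0 < t" "t < 1"
    moreover have "x + ((1 - t) *\<^sub>R a + t *\<^sub>R b) *\<^sub>R (y - x)
      = (1 - t) *\<^sub>R (x + a *\<^sub>R (y - x)) + t *\<^sub>R (x + b *\<^sub>R (y - x))"
      by (simp add: algebra_simps)
    ultimately show "?g ((1 - t) *\<^sub>R a + t *\<^sub>R b) \<le> (1 - t) * ?g a + t * ?g b"
      using convex_onD[OF convex, of t "x + a *\<^sub>R (y - x)" "x + b *\<^sub>R (y - x)"] by simp
  qed auto
  ultimately have "?g 1 - ?g 0 \<ge> 0 * (1 - 0)"
    using convex_on_imp_above_tangent[of UNIV ?g 0 1 0] by (simp add: connected_UNIV)
  then show ?thesis by simp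
qed

text \<open>Both bounds come from a gradient step of length \<open>1 / L\<close>, taken from \<open>x\<close> and from the
  minimizer respectively.\<close>

lemma smooth_min_subgradient_bounds:
  fixes \<phi> :: "'a::euclidean_space \<Rightarrow> real"
  assumes smooth: "smooth_with L \<phi>" and L: "L > 0"
    and min: "\<And>y. \<phi> xs \<le> \<phi> y"
    and sub: "\<And>y. \<phi> y \<ge> \<phi> x + u \<bullet> (y - x)"
  shows "(norm u)\<^sup>2 / (2 * L) \<le> \<phi> x - \<phi> xs"
    and "(norm u)\<^sup>2 / L \<le> u \<bullet> (x - xs)"
proof -
  have diff: "\<phi> differentiable (at y)" for y
    using smooth by (simp add: smooth_with_def)
  have gx: "grad \<phi> x = u" and gxs: "grad \<phi> xs = 0"
    using min by (auto intro!: grad_eq_subgradient diff sub)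
  have upper: "\<phi> y - \<phi> z - grad \<phi> z \<bullet> (y - z) \<le> L / 2 * (norm (y - z))\<^sup>2" for y z
    using smooth by (simp add: smooth_with_def)
  have sq: "L / 2 * (norm ((1 / L) *\<^sub>R u))\<^sup>2 = (norm u)\<^sup>2 / (2 * L)"
    using L by (simp add: power2_eq_square)
  have uu: "u \<bullet> u = (norm u)\<^sup>2"
    by (simp add: power2_norm_eq_inner)
  have half: "(norm u)\<^sup>2 / L = (norm u)\<^sup>2 / (2 * L) + (norm u)\<^sup>2 / (2 * L)"
    by simp
  have "\<phi> (x - (1 / L) *\<^sub>R u) - \<phi> x + (norm u)\<^sup>2 / L \<le> (norm u)\<^sup>2 / (2 * L)"
  proof -
    have "x - (1 / L) *\<^sub>R u - x = - ((1 / L) *\<^sub>R u)"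
      by simp
    then have "\<phi> (x - (1 / L) *\<^sub>R u) - \<phi> x - u \<bullet> (- ((1 / L) *\<^sub>R u)) \<le> (norm u)\<^sup>2 / (2 * L)"
      using upper[of "x - (1 / L) *\<^sub>R u" x] by (simp only: gx norm_minus_cancel sq)
    then show ?thesis
      by (simp add: uu)
  qed
  then show 1: "(norm u)\<^sup>2 / (2 * L) \<le> \<phi> x - \<phi> xs"
    using min[of "x - (1 / L) *\<^sub>R u"] half by linarith
  have "\<phi> (xs + (1 / L) *\<^sub>R u) - \<phi> xs \<le> (norm u)\<^sup>2 / (2 * L)"
    using upper[of "xs + (1 / L) *\<^sub>R u" xs] by (simp only: gxs add_diff_cancel_left' sq) simp
  moreover have "u \<bullet> (xs + (1 / L) *\<^sub>R u - x) = (norm u)\<^sup>2 / L - u \<bullet> (x - xs)"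
    by (simp add: inner_diff_right inner_add_right uu)
  \<comment> \<open>At the step point, smoothness bounds \<open>\<phi>\<close> above by
    \<open>\<phi> xs\<close> plus half of \<open>(norm u)\<^sup>2 / L\<close>, while the subgradient
    at \<open>x\<close> bounds it below. The first claim supplies the other half.\<close>
  ultimately show "(norm u)\<^sup>2 / L \<le> u \<bullet> (x - xs)"
    using 1 half sub[of "xs + (1 / L) *\<^sub>R u"] by linarith
qed

text \<open>\<open>prox\<close> is a Hilbert choice, meaningful once some minimizer exists.
  Existence follows by compactness of a ball outside which no point can compete with
  \<open>x\<close>.\<close>

lemma prox_minimizes:
  fixes \<phi> :: "'a::euclidean_space \<Rightarrow> real"
  assumes \<gamma>: "\<gamma> > 0" and cont: "continuous_on UNIV \<phi>" and below: "\<And>y. m \<le> \<phi> y"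
  shows "\<phi> (prox \<gamma> \<phi> x) + 1 / (2 * \<gamma>) * (norm (prox \<gamma> \<phi> x - x))\<^sup>2
    \<le> \<phi> z + 1 / (2 * \<gamma>) * (norm (z - x))\<^sup>2"
proof -
  let ?F = "\<lambda>z. \<phi> z + 1 / (2 * \<gamma>) * (norm (z - x))\<^sup>2"
  \<comment> \<open>Beyond distance \<open>R\<close> from \<open>x\<close> the penalty exceeds
    \<open>\<phi> x - m\<close>, so the objective exceeds its value \<open>\<phi> x\<close> at
    \<open>x\<close>.\<close>
  define R where "R = sqrt (2 * \<gamma> * (\<phi> x - m))"
  have "compact (cball x R)" "x \<in> cball x R"
    using below[of x] \<gamma> by (auto simp: R_def)
  moreover have "continuous_on (cball x R) ?F"
    by (intro continuous_intros continuous_on_subset[OF cont]) auto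
  ultimately have "\<exists>p\<in>cball x R. \<forall>z\<in>cball x R. ?F p \<le> ?F z"
    by (intro continuous_attains_inf) auto
  then obtain p where p: "p \<in> cball x R" "\<And>z. z \<in> cball x R \<Longrightarrow> ?F p \<le> ?F z"
    by blast
  have "?F p \<le> ?F z" for z
  proof (cases "z \<in> cball x R")
    case False
    then have "sqrt (2 * \<gamma> * (\<phi> x - m)) < norm (z - x)"
      by (simp add: R_def dist_norm norm_minus_commute)
    then have "2 * \<gamma> * (\<phi> x - m) < (norm (z - x))\<^sup>2"
      by (meson not_le real_le_rsqrt)
    then have "\<phi> x - m \<le> 1 / (2 * \<gamma>) * (norm (z - x))\<^sup>2"
      using \<gamma> by (simp add: field_simps)
    moreover have "?F p \<le> \<phi> x"
      using p(2)[OF \<open>x \<in> cball x R\<close>] by simp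
    ultimately show ?thesis
      using below[of z] by linarith
  qed (rule p(2))
  then have "is_arg_min ?F (\<lambda>_. True) p"
    by (simp add: is_arg_min_linorder)
  then have "is_arg_min ?F (\<lambda>_. True) (prox \<gamma> \<phi> x)"
    unfolding prox_def arg_min_def by (rule someI)
  then show ?thesis
    by (simp add: is_arg_min_linorder)
qed

text \<open>Fermat's rule for the prox problem: along a segment from the minimizer the quadratic
  term contributes its linear part and a second-order remainder.\<close>

lemma prox_subgradient:
  fixes \<phi> :: "'a::euclidean_space \<Rightarrow> real"
  assumes convex: "convex_on UNIV \<phi>" and \<gamma>: "\<gamma> > 0" and below: "\<And>y. m \<le> \<phi> y"
  shows "\<phi> z \<ge> \<phi> (prox \<gamma> \<phi> x) + (1 / \<gamma>) *\<^sub>R (x - prox \<gamma> \<phi> x) \<bullet> (z - prox \<gamma> \<phi> x)"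
proof -
  let ?p = "prox \<gamma> \<phi> x"
  define c where "c = (norm (z - ?p))\<^sup>2 / (2 * \<gamma>)"
  \<comment> \<open>\<open>d\<close> is the amount by which the inequality would fail. Minimality
    along the segment gives \<open>d \<le> t * c\<close> for all small positive \<open>t\<close>,
    and letting \<open>t\<close> tend to 0 forces \<open>d \<le> 0\<close>.\<close>
  define d where "d = \<phi> ?p + (1 / \<gamma>) *\<^sub>R (x - ?p) \<bullet> (z - ?p) - \<phi> z"
  have cont: "continuous_on UNIV \<phi>"
    using convex convex_on_continuous open_UNIV by blast
  have seg: "d \<le> t * c" if t: "0 < t" "t \<le> 1" for t
  proof -
    let ?w = "(1 - t) *\<^sub>R ?p + t *\<^sub>R z"
    have w: "?w - x = (?p - x) + t *\<^sub>R (z - ?p)"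
      by (simp add: algebra_simps)
    have "(norm (?w - x))\<^sup>2
      = (norm (?p - x))\<^sup>2 + 2 * t * ((?p - x) \<bullet> (z - ?p)) + t * t * (norm (z - ?p))\<^sup>2"
      unfolding w power2_norm_eq_inner
      by (simp add: inner_add_left inner_add_right inner_commute)
    then have "1 / (2 * \<gamma>) * (norm (?w - x))\<^sup>2 = 1 / (2 * \<gamma>) * (norm (?p - x))\<^sup>2
      - t * ((1 / \<gamma>) *\<^sub>R (x - ?p) \<bullet> (z - ?p)) + t * (t * c)"
      using \<gamma> by (simp add: c_def field_simps power2_eq_square inner_diff_left)
    moreover have "\<phi> ?p + 1 / (2 * \<gamma>) * (norm (?p - x))\<^sup>2
      \<le> \<phi> ?w + 1 / (2 * \<gamma>) * (norm (?w - x))\<^sup>2"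
      by (rule prox_minimizes[OF \<gamma> cont below])
    moreover have "\<phi> ?w \<le> (1 - t) * \<phi> ?p + t * \<phi> z"
      using convex_onD[OF convex, of t] t by simp
    ultimately have "t * d \<le> t * (t * c)"
      by (simp add: d_def algebra_simps)
    then show ?thesis
      using t by simp
  qed
  have "((\<lambda>t. t * c) \<longlongrightarrow> 0 * c) (at_right 0)"
    by (intro tendsto_intros)
  moreover have "\<forall>\<^sub>F t in at_right 0. d \<le> t * c"
    unfolding eventually_at_right_field
    by (rule exI[of _ 1]) (use seg in auto)
  ultimately have "d \<le> 0"
    using tendsto_lowerbound[of "\<lambda>t. t * c" 0 "at_right 0" d] by simp
  then show ?thesis
    by (simp add: d_def)
qed

section \<open>The Moreau envelope: values, subgradients and gap\<close>

context
  fixes \<phi> :: "'a::euclidean_space \<Rightarrow> real" and \<gamma> m :: real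
  assumes convex: "convex_on UNIV \<phi>" and \<gamma>: "\<gamma> > 0" and below: "\<And>y. m \<le> \<phi> y"
begin

lemma moreau_eq_prox:
  "moreau \<gamma> \<phi> x = \<phi> (prox \<gamma> \<phi> x) + 1 / (2 * \<gamma>) * (norm (prox \<gamma> \<phi> x - x))\<^sup>2"
  unfolding moreau_def
  using prox_minimizes[OF \<gamma> convex_on_continuous[OF open_UNIV convex] below]
  by (intro cInf_eq_minimum) auto

lemma moreau_ge: "m \<le> moreau \<gamma> \<phi> x"
  using below[of "prox \<gamma> \<phi> x"] \<gamma> by (simp add: moreau_eq_prox add_increasing2)

lemma moreau_le: "moreau \<gamma> \<phi> x \<le> \<phi> x"
  using prox_minimizes[OF \<gamma> convex_on_continuous[OF open_UNIV convex] below, of x x]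
  by (simp add: moreau_eq_prox)

text \<open>Apply the prox subgradient of \<open>\<phi>\<close> at \<open>?p\<close> to the prox
  point \<open>?q\<close> of \<open>y\<close>. With the displacements \<open>v\<close> and
  \<open>w\<close>, the quadratic terms left over form the square
  \<open>1 / (2 * \<gamma>) * (norm (v - w))\<^sup>2\<close>, which is nonnegative.\<close>

lemma moreau_subgradient:
  "moreau \<gamma> \<phi> y \<ge> moreau \<gamma> \<phi> x + (1 / \<gamma>) *\<^sub>R (x - prox \<gamma> \<phi> x) \<bullet> (y - x)"
proof -
  let ?p = "prox \<gamma> \<phi> x" and ?q = "prox \<gamma> \<phi> y"
  define v w where "v = x - ?p" and "w = y - ?q"
  have qp: "?q - ?p = (y - x) + v - w"
    by (simp add: v_def w_def)
  have "\<phi> ?q \<ge> \<phi> ?p + (1 / \<gamma>) *\<^sub>R v \<bullet> (?q - ?p)"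
    using prox_subgradient[OF convex \<gamma> below] by (simp add: v_def)
  moreover have "0 \<le> 1 / (2 * \<gamma>) * (norm (v - w))\<^sup>2"
    using \<gamma> by simp
  moreover have "1 / (2 * \<gamma>) * (norm (v - w))\<^sup>2
      = (1 / (2 * \<gamma>)) * (norm v)\<^sup>2 + 1 / (2 * \<gamma>) * (norm w)\<^sup>2 - (1 / \<gamma>) * (v \<bullet> w)"
    using \<gamma> by (simp add: power2_norm_eq_inner inner_diff_left inner_diff_right
      inner_commute field_simps)
  moreover have "(1 / \<gamma>) *\<^sub>R v \<bullet> (?q - ?p)
      = (1 / \<gamma>) *\<^sub>R v \<bullet> (y - x) + 2 * (1 / (2 * \<gamma>) * (norm v)\<^sup>2) - (1 / \<gamma>) * (v \<bullet> w)"
    unfolding qp using \<gamma>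
    by (simp add: power2_norm_eq_inner inner_diff_right inner_add_right algebra_simps)
  ultimately show ?thesis
    unfolding moreau_eq_prox norm_minus_commute[of ?p] norm_minus_commute[of ?q]
      v_def[symmetric] w_def[symmetric]
    by linarith
qed

end

lemma moreau_at_minimum:
  fixes \<phi> :: "'a::euclidean_space \<Rightarrow> real"
  assumes "convex_on UNIV \<phi>" "\<gamma> > 0" "\<And>y. \<phi> xs \<le> \<phi> y"
  shows "moreau \<gamma> \<phi> xs = \<phi> xs"
  using moreau_ge[OF assms] moreau_le[OF assms] by (rule antisym[rotated])

text \<open>Cocoercivity holds at the prox point with constant \<open>1 / L\<close>. Replacing the
  prox point by \<open>x = prox \<gamma> \<phi> x + \<gamma> *\<^sub>R u\<close> in the inner
  product adds \<open>\<gamma> * (norm u)\<^sup>2\<close>, so the constants add up to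
  \<open>1 / L + \<gamma> = (1 + \<gamma> * L) / L\<close>.\<close>

lemma prox_displacement_bound:
  fixes \<phi> :: "'a::euclidean_space \<Rightarrow> real"
  assumes convex: "convex_on UNIV \<phi>" and \<gamma>: "\<gamma> > 0" and min: "\<And>y. \<phi> xs \<le> \<phi> y"
    and smooth: "smooth_with L \<phi>" and L: "L > 0"
    and u: "u = (1 / \<gamma>) *\<^sub>R (x - prox \<gamma> \<phi> x)"
  shows "(norm u)\<^sup>2 \<le> L / (1 + \<gamma> * L) * (u \<bullet> (x - xs))"
proof -
  have "(norm u)\<^sup>2 / L \<le> u \<bullet> (prox \<gamma> \<phi> x - xs)"
    unfolding u
    by (rule smooth_min_subgradient_bounds(2)[OF smooth L min prox_subgradient[OF convex \<gamma> min]])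
  moreover have "x - xs = (prox \<gamma> \<phi> x - xs) + \<gamma> *\<^sub>R u"
    using \<gamma> by (simp add: u)
  then have "u \<bullet> (x - xs) = u \<bullet> (prox \<gamma> \<phi> x - xs) + \<gamma> * (norm u)\<^sup>2"
    by (simp only: inner_add_right inner_scaleR_right power2_norm_eq_inner)
  ultimately have "(norm u)\<^sup>2 / L + \<gamma> * (norm u)\<^sup>2 \<le> u \<bullet> (x - xs)"
    by simp
  moreover have "0 < 1 + \<gamma> * L"
    using \<gamma> L by (simp add: add_pos_pos)
  ultimately show ?thesis
    using L by (simp add: field_simps)
qed

text \<open>Smoothness at the prox point \<open>p\<close> limits the rise of \<open>\<phi>\<close>
  from \<open>p\<close> to \<open>x\<close> by a multiple of \<open>a\<close>. The envelope penalty
  covers part of it, and the gap of \<open>\<phi>\<close> at \<open>p\<close>, itself at least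
  \<open>a / (2 * L)\<close>, covers the rest.\<close>

lemma moreau_gap_lower_bound:
  fixes \<phi> :: "'a::euclidean_space \<Rightarrow> real"
  assumes convex: "convex_on UNIV \<phi>" and \<gamma>: "\<gamma> > 0" and min: "\<And>y. \<phi> xs \<le> \<phi> y"
    and smooth: "smooth_with L \<phi>" and L: "L > 0"
  shows "(\<phi> x - \<phi> xs) / (1 + \<gamma> * L) \<le> moreau \<gamma> \<phi> x - moreau \<gamma> \<phi> xs"
proof -
  define p where "p = prox \<gamma> \<phi> x"
  define u where "u = (1 / \<gamma>) *\<^sub>R (x - p)"
  define a where "a = (norm u)\<^sup>2"
  have sub: "\<phi> z \<ge> \<phi> p + u \<bullet> (z - p)" for z
    unfolding u_def p_def by (rule prox_subgradient[OF convex \<gamma> min])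
  have "a / (2 * L) \<le> \<phi> p - \<phi> xs"
    unfolding a_def by (rule smooth_min_subgradient_bounds(1)[OF smooth L min sub])
  then have "\<gamma> * L * (a / (2 * L)) \<le> \<gamma> * L * (\<phi> p - \<phi> xs)"
    using \<gamma> L by (intro mult_left_mono) auto
  then have 1: "\<gamma> / 2 * a \<le> \<gamma> * L * (\<phi> p - \<phi> xs)"
    using L by simp
  have g: "grad \<phi> p = u"
    using smooth by (intro grad_eq_subgradient sub) (simp add: smooth_with_def)
  have xp: "x - p = \<gamma> *\<^sub>R u"
    using \<gamma> by (simp add: u_def)
  have "\<phi> x - \<phi> p - u \<bullet> (x - p) \<le> L / 2 * (norm (x - p))\<^sup>2"
    using smooth unfolding smooth_with_def g[symmetric] by blast
  then have 2: "\<phi> x - \<phi> p - \<gamma> * a \<le> L / 2 * (\<gamma>\<^sup>2 * a)"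
    unfolding xp a_def by (simp add: power_mult_distrib flip: power2_norm_eq_inner)
  have "moreau \<gamma> \<phi> x - moreau \<gamma> \<phi> xs = \<phi> p + 1 / (2 * \<gamma>) * (norm (p - x))\<^sup>2 - \<phi> xs"
    using moreau_at_minimum[OF convex \<gamma> min] moreau_eq_prox[OF convex \<gamma> min]
    by (simp add: p_def)
  also have "1 / (2 * \<gamma>) * (norm (p - x))\<^sup>2 = \<gamma> / 2 * a"
    unfolding norm_minus_commute[of p] xp a_def using \<gamma>
    by (simp add: power_mult_distrib power2_eq_square)
  finally have gap: "moreau \<gamma> \<phi> x - moreau \<gamma> \<phi> xs = \<phi> p + \<gamma> / 2 * a - \<phi> xs" .
  \<comment> \<open>By fact \<open>1\<close> the second summand is at least
    \<open>\<gamma> / 2 * a\<close>. Together with the third it yields the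
    \<open>\<gamma> * a\<close> of fact \<open>2\<close>, and the last summand matches the
    right-hand side of \<open>2\<close>.\<close>
  have "(1 + \<gamma> * L) * (moreau \<gamma> \<phi> x - moreau \<gamma> \<phi> xs)
    = \<phi> p - \<phi> xs + \<gamma> * L * (\<phi> p - \<phi> xs) + \<gamma> / 2 * a + L / 2 * (\<gamma>\<^sup>2 * a)"
    unfolding gap by (simp add: algebra_simps power2_eq_square)
  with 1 2 have "\<phi> x - \<phi> xs \<le> (1 + \<gamma> * L) * (moreau \<gamma> \<phi> x - moreau \<gamma> \<phi> xs)"
    by linarith
  moreover have "0 < 1 + \<gamma> * L"
    using \<gamma> L by (simp add: add_pos_pos)
  ultimately show ?thesis
    by (simp add: divide_le_eq mult.commute)
qed

section \<open>Moments of uniform samples without replacement\<close>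

lemma card_subsets_containing:
  assumes "finite U" "T \<subseteq> U" "card T \<le> k"
  shows "card {A. A \<subseteq> U \<and> card A = k \<and> T \<subseteq> A} = (card U - card T) choose (k - card T)"
proof -
  have fT: "finite T"
    using assms finite_subset by blast
  have "bij_betw (\<lambda>B. B \<union> T) {B. B \<subseteq> U - T \<and> card B = k - card T}
    {A. A \<subseteq> U \<and> card A = k \<and> T \<subseteq> A}"
  proof (rule bij_betw_byWitness[where f' = "\<lambda>A. A - T"])
    show "(\<lambda>B. B \<union> T) ` {B. B \<subseteq> U - T \<and> card B = k - card T}
      \<subseteq> {A. A \<subseteq> U \<and> card A = k \<and> T \<subseteq> A}"
    proof safe
      fix B assume B: "B \<subseteq> U - T" "card B = k - card T"
      then have "card (B \<union> T) = card B + card T"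
        using assms fT by (intro card_Un_disjoint) (auto intro: finite_subset)
      then show "card (B \<union> T) = k"
        using B assms by simp
    qed (use assms in auto)
    show "(\<lambda>A. A - T) ` {A. A \<subseteq> U \<and> card A = k \<and> T \<subseteq> A}
      \<subseteq> {B. B \<subseteq> U - T \<and> card B = k - card T}"
      using fT by (auto simp: card_Diff_subset)
  qed auto
  then show ?thesis
    using assms fT by (simp add: bij_betw_same_card[symmetric] n_subsets card_Diff_subset)
qed

lemma finite_tau_subsets: "finite (tau_subsets n \<tau>)"
  unfolding tau_subsets_def by (rule finite_subset[of _ "Pow {1..n}"]) auto

lemma card_tau_subsets: "card (tau_subsets n \<tau>) = n choose \<tau>"
  unfolding tau_subsets_def using n_subsets[of "{1..n}" \<tau>] by simp

lemma tau_subsets_nonempty: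
  assumes "\<tau> \<le> n" shows "tau_subsets n \<tau> \<noteq> {}"
  using assms card_tau_subsets[of n \<tau>] by (metis binomial_eq_0_iff card.empty not_less)

text \<open>The inclusion probability of one index, in unnormalized form, from the absorption
  identity for binomial coefficients. Absorbing twice gives the probability for a pair
  below.\<close>

lemma card_tau_subsets_one:
  assumes i: "i \<in> {1..n}" and \<tau>: "1 \<le> \<tau>"
  shows "real (card {A \<in> tau_subsets n \<tau>. i \<in> A}) = real \<tau> / real n * real (n choose \<tau>)"
proof -
  have "{A \<in> tau_subsets n \<tau>. i \<in> A} = {A. A \<subseteq> {1..n} \<and> card A = \<tau> \<and> {i} \<subseteq> A}"
    by (auto simp: tau_subsets_def)
  then have "card {A \<in> tau_subsets n \<tau>. i \<in> A} = (n - 1) choose (\<tau> - 1)"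
    using card_subsets_containing[of "{1..n}" "{i}" \<tau>] i \<tau> by simp
  moreover have "\<tau> * (n choose \<tau>) = n * ((n - 1) choose (\<tau> - 1))"
    using times_binomial_minus1_eq[of \<tau> n] \<tau> by simp
  then have "real \<tau> * real (n choose \<tau>) = real n * real ((n - 1) choose (\<tau> - 1))"
    by (metis of_nat_mult)
  ultimately show ?thesis
    using i by (simp add: field_simps)
qed

lemma card_tau_subsets_two:
  assumes ij: "i \<in> {1..n}" "j \<in> {1..n}" "i \<noteq> j" and \<tau>: "1 \<le> \<tau>"
  shows "real (card {A \<in> tau_subsets n \<tau>. i \<in> A \<and> j \<in> A})
    = real \<tau> * (real \<tau> - 1) / (real n * (real n - 1)) * real (n choose \<tau>)"
proof (cases "\<tau> = 1")
  \<comment> \<open>Treated apart because the count below chooses \<open>\<tau> - 2\<close> further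
    elements, and this natural subtraction would truncate. Here both sides are 0.\<close>
  case True
  then have "{A \<in> tau_subsets n \<tau>. i \<in> A \<and> j \<in> A} = {}"
    using ij by (auto simp: tau_subsets_def card_1_singleton_iff)
  then show ?thesis
    using True by (simp only: card.empty)  simp
next
  case False
  then have \<tau>2: "2 \<le> \<tau>" and n2: "2 \<le> n"
    using \<tau> ij by auto
  have "{A \<in> tau_subsets n \<tau>. i \<in> A \<and> j \<in> A} = {A. A \<subseteq> {1..n} \<and> card A = \<tau> \<and> {i, j} \<subseteq> A}"
    by (auto simp: tau_subsets_def)
  then have c: "card {A \<in> tau_subsets n \<tau>. i \<in> A \<and> j \<in> A} = (n - 2) choose (\<tau> - 2)"
    using card_subsets_containing[of "{1..n}" "{i, j}" \<tau>] ij \<tau>2 by (simp add: numeral_2_eq_2)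
  have "\<tau> * (n choose \<tau>) = n * ((n - 1) choose (\<tau> - 1))"
    using times_binomial_minus1_eq[of \<tau> n] \<tau> by simp
  moreover have "(\<tau> - 1) * ((n - 1) choose (\<tau> - 1)) = (n - 1) * ((n - 2) choose (\<tau> - 2))"
    using times_binomial_minus1_eq[of "\<tau> - 1" "n - 1"] \<tau>2 by (simp add: numeral_2_eq_2)
  ultimately have "(\<tau> - 1) * (\<tau> * (n choose \<tau>)) = n * ((n - 1) * ((n - 2) choose (\<tau> - 2)))"
    by (metis mult.left_commute)
  then have "real (\<tau> - 1) * (real \<tau> * real (n choose \<tau>))
      = real n * (real (n - 1) * real ((n - 2) choose (\<tau> - 2)))"
    by (metis of_nat_mult)
  then show ?thesis
    using c n2 \<tau>2 by (simp add: of_nat_diff field_simps)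
qed

lemma sum_tau_subsets_sum:
  fixes g :: "nat \<Rightarrow> 'b::real_vector"
  assumes \<tau>: "1 \<le> \<tau>"
  shows "(\<Sum>A\<in>tau_subsets n \<tau>. \<Sum>i\<in>A. g i)
    = (real \<tau> / real n * real (n choose \<tau>)) *\<^sub>R (\<Sum>i\<in>{1..n}. g i)"
proof -
  have "(\<Sum>A\<in>tau_subsets n \<tau>. \<Sum>i\<in>A. g i)
      = (\<Sum>A\<in>tau_subsets n \<tau>. \<Sum>i\<in>{i \<in> {1..n}. i \<in> A}. g i)"
    by (intro sum.cong) (auto simp: tau_subsets_def)
  also have "\<dots> = (\<Sum>i\<in>{1..n}. \<Sum>A\<in>{A \<in> tau_subsets n \<tau>. i \<in> A}. g i)"
    by (rule sum.swap_restrict) (auto simp: finite_tau_subsets)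
  also have "\<dots> = (\<Sum>i\<in>{1..n}. (real \<tau> / real n * real (n choose \<tau>)) *\<^sub>R g i)"
    using card_tau_subsets_one[OF _ \<tau>] by (intro sum.cong) (auto simp: sum_constant_scaleR)
  finally show ?thesis
    by (simp add: scaleR_right.sum)
qed

text \<open>Expand each square into a sum over ordered pairs and exchange it with the sum over
  subsets. Diagonal pairs occur \<open>c1\<close> times and the others \<open>c2\<close> times, so
  the total is \<open>c2\<close> times the full double sum plus \<open>c1 - c2\<close> times the
  diagonal.\<close>

lemma sum_tau_subsets_norm_sum:
  fixes u :: "nat \<Rightarrow> 'a::real_inner"
  assumes \<tau>: "1 \<le> \<tau>" and n: "2 \<le> n"
  shows "(\<Sum>A\<in>tau_subsets n \<tau>. (norm (\<Sum>i\<in>A. u i))\<^sup>2)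
    = real (n choose \<tau>) * (real \<tau> * (real n - real \<tau>) / (real n * (real n - 1))
         * (\<Sum>i\<in>{1..n}. (norm (u i))\<^sup>2)
       + real \<tau> * (real \<tau> - 1) / (real n * (real n - 1)) * (norm (\<Sum>i\<in>{1..n}. u i))\<^sup>2)"
proof -
  let ?N = "real (n choose \<tau>)" and ?I = "{1..n} \<times> {1..n}"
  define c1 where "c1 = real \<tau> / real n * ?N"
  define c2 where "c2 = real \<tau> * (real \<tau> - 1) / (real n * (real n - 1)) * ?N"
  have sq: "(norm (\<Sum>i\<in>A. u i))\<^sup>2 = (\<Sum>(i, j)\<in>A \<times> A. u i \<bullet> u j)" for A
    by (simp add: power2_norm_eq_inner inner_sum_left inner_sum_right inner_commute
      sum.cartesian_product)
  have "(\<Sum>A\<in>tau_subsets n \<tau>. (norm (\<Sum>i\<in>A. u i))\<^sup>2)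
      = (\<Sum>A\<in>tau_subsets n \<tau>. \<Sum>q\<in>{q \<in> ?I. fst q \<in> A \<and> snd q \<in> A}. u (fst q) \<bullet> u (snd q))"
    unfolding sq by (intro sum.cong) (auto simp: tau_subsets_def case_prod_beta)
  also have "\<dots> = (\<Sum>q\<in>?I. \<Sum>A\<in>{A \<in> tau_subsets n \<tau>. fst q \<in> A \<and> snd q \<in> A}. u (fst q) \<bullet> u (snd q))"
    by (rule sum.swap_restrict) (auto simp: finite_tau_subsets)
  also have "\<dots> = (\<Sum>(i, j)\<in>?I. c2 * (u i \<bullet> u j) + (if i = j then (c1 - c2) * (norm (u i))\<^sup>2 else 0))"
  proof (intro sum.cong refl, clarify)
    fix i j assume ij: "i \<in> {1..n}" "j \<in> {1..n}"
    show "(\<Sum>A\<in>{A \<in> tau_subsets n \<tau>. fst (i, j) \<in> A \<and> snd (i, j) \<in> A}. u (fst (i, j)) \<bullet> u (snd (i, j)))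
      = c2 * (u i \<bullet> u j) + (if i = j then (c1 - c2) * (norm (u i))\<^sup>2 else 0)"
      using card_tau_subsets_one[OF ij(1) \<tau>] card_tau_subsets_two[OF ij _ \<tau>]
      by (cases "i = j") (auto simp: c1_def c2_def power2_norm_eq_inner algebra_simps)
  qed
  also have "\<dots> = c2 * (\<Sum>(i, j)\<in>?I. u i \<bullet> u j)
      + (\<Sum>(i, j)\<in>?I. if i = j then (c1 - c2) * (norm (u i))\<^sup>2 else 0)"
    by (simp add: case_prod_beta sum.distrib sum_distrib_left)
  also have "(\<Sum>(i, j)\<in>?I. if i = j then (c1 - c2) * (norm (u i))\<^sup>2 else 0)
      = (c1 - c2) * (\<Sum>i\<in>{1..n}. (norm (u i))\<^sup>2)"
    by (simp add: sum.cartesian_product[symmetric] sum_distrib_left)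
  also have "c1 - c2 = ?N * (real \<tau> * (real n - real \<tau>) / (real n * (real n - 1)))"
    using n by (simp add: c1_def c2_def field_simps)
  finally show ?thesis
    unfolding sq[symmetric] c2_def by (simp add: algebra_simps)
qed

section \<open>Contractions driven by independent uniform samples\<close>

text \<open>The first \<open>k\<close> samples have the product of uniform measures as joint law.
  Integrating out the last coordinate by Fubini turns the one-step average bound into a recursion
  for the expectations. The products live on finite sets, where every real function is measurable
  and integrable.\<close>

lemma iid_uniform_contraction:
  fixes Z :: "(nat \<Rightarrow> 'b) \<Rightarrow> nat \<Rightarrow> 'c" and V :: "'c \<Rightarrow> real"
  assumes P: "prob_space P" and T: "finite T" "T \<noteq> {}"
    and indep: "prob_space.indep_vars P (\<lambda>_. count_space T) S UNIV"
    and law: "\<And>k. distr P (count_space T) (S k) = uniform_count_measure T"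
    and Z0: "\<And>s. Z s 0 = x0" and ZSuc: "\<And>s k. Z s (Suc k) = step (s k) (Z s k)"
    and r: "0 \<le> r"
    and contr: "\<And>x. (\<Sum>A\<in>T. V (step A x)) / card T \<le> r * V x"
  shows "prob_space.expectation P (\<lambda>\<omega>. V (Z (\<lambda>j. S j \<omega>) K)) \<le> r ^ K * V x0"
proof -
  interpret P: prob_space P by (rule P)
  define U where "U = uniform_count_measure T"
  have U: "prob_space U"
    unfolding U_def by (rule prob_space_uniform_count_measure[OF T])
  interpret U: product_prob_space "\<lambda>_::nat. U"
    by (intro product_prob_spaceI U)
  have sets_U: "sets U = sets (count_space T)"
    by (simp add: U_def sets_uniform_count_measure)
  have sets_PiM: "sets (PiM {..<k} (\<lambda>_. U)) = Pow ({..<k} \<rightarrow>\<^sub>E T)" for k :: nat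
  proof -
    have "sets (PiM {..<k} (\<lambda>_. U)) = sets (PiM {..<k} (\<lambda>_. count_space T))"
      by (intro sets_PiM_cong refl sets_U)
    then show ?thesis
      using T by (simp add: count_space_PiM_finite countable_finite)
  qed
  have space_PiM': "space (PiM {..<k} (\<lambda>_. U)) = ({..<k} \<rightarrow>\<^sub>E T)" for k :: nat
    by (simp add: space_PiM U_def space_uniform_count_measure)
  have meas: "h \<in> borel_measurable (PiM {..<k} (\<lambda>_. U))" for h :: "(nat \<Rightarrow> 'b) \<Rightarrow> real" and k
    unfolding measurable_def space_PiM' sets_PiM by auto
  have integ: "integrable (PiM {..<k} (\<lambda>_. U)) h" for h :: "(nat \<Rightarrow> 'b) \<Rightarrow> real" and k
  proof -
    interpret Pk: prob_space "PiM {..<k} (\<lambda>_. U)"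
      by (intro prob_space_PiM U)
    have "finite ({..<k} \<rightarrow>\<^sub>E T)"
      using T by (intro finite_PiE) auto
    then have "AE s in PiM {..<k} (\<lambda>_. U). norm (h s) \<le> Max ((\<lambda>s. norm (h s)) ` ({..<k} \<rightarrow>\<^sub>E T))"
      by (intro AE_I2) (auto simp: space_PiM' intro!: Max_ge)
    then show ?thesis
      by (rule Pk.integrable_const_bound[OF _ meas])
  qed
  define E where "E k = (\<integral>s. V (Z s k) \<partial>PiM {..<k} (\<lambda>_. U))" for k
  \<comment> \<open>The state at time \<open>k\<close> reads only the coordinates below
    \<open>k\<close>. Hence \<open>E k\<close> can be an integral over \<open>k\<close> coordinates,
    and coordinate \<open>k\<close> is fresh for the next step.\<close>
  have Z_cong: "Z s k = Z s' k" if "\<And>j. j < k \<Longrightarrow> s j = s' j" for s s' k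
    using that by (induction k) (auto simp: Z0 ZSuc)
  have E_Suc: "E (Suc k) \<le> r * E k" for k
  proof -
    have "E (Suc k) = (\<integral>s. (\<integral>A. V (Z (s(k := A)) (Suc k)) \<partial>U) \<partial>PiM {..<k} (\<lambda>_. U))"
      unfolding E_def lessThan_Suc
      by (rule U.product_integral_insert) (use integ[of "Suc k"] in \<open>auto simp: lessThan_Suc\<close>)
    also have "\<dots> = (\<integral>s. (\<Sum>A\<in>T. V (step A (Z s k))) / card T \<partial>PiM {..<k} (\<lambda>_. U))"
    proof -
      have "Z (s(k := A)) k = Z s k" for s A
        by (rule Z_cong) simp
      then show ?thesis
        using T by (simp add: ZSuc U_def integral_uniform_count_measure)
    qed
    also have "\<dots> \<le> (\<integral>s. r * V (Z s k) \<partial>PiM {..<k} (\<lambda>_. U))"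
      by (intro integral_mono integ contr)
    finally show ?thesis
      by (simp add: E_def)
  qed
  have E_le: "E k \<le> r ^ k * V x0" for k
  proof (induction k)
    case 0
    interpret P0: prob_space "PiM {..<0::nat} (\<lambda>_. U)"
      by (intro prob_space_PiM U)
    show ?case
      by (simp add: E_def Z0 P0.prob_space del: lessThan_0)
  next
    case (Suc k)
    then show ?case
      using E_Suc[of k] mult_left_mono[OF Suc r] by (simp add: mult.assoc)
  qed
  have rv: "P.random_variable (count_space T) (S k)" for k
    using indep by (simp add: P.indep_vars_def2)
  have "P.expectation (\<lambda>\<omega>. V (Z (\<lambda>j. S j \<omega>) K)) = E K"
  \<comment> \<open>The characterization of independence by the joint law is applied to the index
    set \<open>{..<K}\<close>, which must be nonempty.\<close>
  proof (cases "K = 0")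
    case True
    interpret P0: prob_space "PiM {..<0::nat} (\<lambda>_. U)"
      by (intro prob_space_PiM U)
    show ?thesis
      using True by (simp add: E_def Z0 P.prob_space P0.prob_space del: lessThan_0)
  next
    case False
    let ?R = "\<lambda>\<omega>. \<lambda>j\<in>{..<K}. S j \<omega>"
    have "P.indep_vars (\<lambda>_. count_space T) S {..<K}"
      using indep P.indep_vars_subset by blast
    then have distr: "distr P (PiM {..<K} (\<lambda>_. count_space T)) ?R = PiM {..<K} (\<lambda>_. U)"
      using False rv by (subst (asm) P.indep_vars_iff_distr_eq_PiM') (auto simp: law U_def)
    have "E K = (\<integral>s. V (Z s K) \<partial>distr P (PiM {..<K} (\<lambda>_. count_space T)) ?R)"
      by (simp add: E_def distr)
    also have "\<dots> = P.expectation (\<lambda>\<omega>. V (Z (?R \<omega>) K))"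
    proof (rule integral_distr)
      show "?R \<in> measurable P (PiM {..<K} (\<lambda>_. count_space T))"
        using rv by (intro measurable_restrict)
      show "(\<lambda>s. V (Z s K)) \<in> borel_measurable (PiM {..<K} (\<lambda>_. count_space T))"
        using meas[of _ K] sets_PiM_cong[OF refl sets_U, of "{..<K}"]
        by (metis measurable_cong_sets)
    qed
    also have "(\<lambda>\<omega>. V (Z (?R \<omega>) K)) = (\<lambda>\<omega>. V (Z (\<lambda>j. S j \<omega>) K))"
      using Z_cong[of K] by (metis lessThan_iff restrict_apply')
    finally show ?thesis ..
  qed
  with E_le show ?thesis
    by simp
qed

section \<open>One step of FedExProx\<close>

lemma frac_one_plus_mono:
  fixes a b \<gamma> :: real
  assumes "0 < a" "a \<le> b" "0 < \<gamma>"
  shows "a / (1 + \<gamma> * a) \<le> b / (1 + \<gamma> * b)"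
proof -
  have "0 < 1 + \<gamma> * a" "0 < 1 + \<gamma> * b"
    using assms by (simp_all add: add_pos_pos)
  then show ?thesis
    using assms by (simp add: frac_le_eq divide_le_eq le_divide_eq algebra_simps)
qed

locale fedexprox_interpolation =
  fixes f :: "nat \<Rightarrow> 'a::euclidean_space \<Rightarrow> real" and L :: "nat \<Rightarrow> real"
    and n :: nat and \<mu> \<gamma> L\<gamma> Lmax :: real and xstar :: 'a
  assumes n: "n \<ge> 2"
    and f_convex: "\<And>i. i \<in> {1..n} \<Longrightarrow> convex_on UNIV (f i)"
    and L_pos: "\<And>i. i \<in> {1..n} \<Longrightarrow> L i > 0"
    and Lmax: "\<And>i. i \<in> {1..n} \<Longrightarrow> L i \<le> Lmax"
    and f_smooth: "\<And>i. i \<in> {1..n} \<Longrightarrow> smooth_with (L i) (f i)"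
    and f_strong: "strongly_convex \<mu> (avg_fun n f)"
    and interpolation: "\<And>i. i \<in> {1..n} \<Longrightarrow> grad (f i) xstar = 0"
    and \<gamma>: "\<gamma> > 0"
    and L\<gamma>_pos: "L\<gamma> > 0"
    and L\<gamma>_smooth: "smooth_with L\<gamma> (avg_fun n (\<lambda>i. moreau \<gamma> (f i)))"
begin

definition u :: "nat \<Rightarrow> 'a \<Rightarrow> 'a" where
  "u i x = (1 / \<gamma>) *\<^sub>R (x - prox \<gamma> (f i) x)"

definition ubar :: "'a \<Rightarrow> 'a" where
  "ubar x = (1 / real n) *\<^sub>R (\<Sum>i\<in>{1..n}. u i x)"

lemma n_pos: "0 < real n"
  using n by simp

lemma Lmax_pos: "0 < Lmax"
  using L_pos[of 1] Lmax[of 1] n by simp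

lemma denom_pos: "0 < 1 + \<gamma> * Lmax"
  using \<gamma> Lmax_pos by (simp add: add_pos_pos)

lemma f_min: "i \<in> {1..n} \<Longrightarrow> f i xstar \<le> f i y"
  using f_smooth by (intro convex_grad_zero_imp_minimum f_convex interpolation)
    (auto simp: smooth_with_def)

lemma avg_fun_le:
  assumes "\<And>i. i \<in> {1..n} \<Longrightarrow> g i x \<le> h i y"
  shows "avg_fun n g x \<le> avg_fun n h y"
  unfolding avg_fun_def using assms by (intro mult_left_mono sum_mono) auto

lemma ubar_inner: "ubar x \<bullet> v = 1 / real n * (\<Sum>i\<in>{1..n}. u i x \<bullet> v)"
  by (simp add: ubar_def inner_sum_left)

lemma avg_moreau_subgradient:
  "avg_fun n (\<lambda>i. moreau \<gamma> (f i)) y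
     \<ge> avg_fun n (\<lambda>i. moreau \<gamma> (f i)) x + ubar x \<bullet> (y - x)"
proof -
  have "1 / real n * (\<Sum>i\<in>{1..n}. moreau \<gamma> (f i) x + u i x \<bullet> (y - x))
    \<le> 1 / real n * (\<Sum>i\<in>{1..n}. moreau \<gamma> (f i) y)"
    unfolding u_def
    by (intro mult_left_mono sum_mono moreau_subgradient[OF f_convex \<gamma> f_min]) auto
  then show ?thesis
    by (simp add: ubar_inner avg_fun_def sum.distrib distrib_left)
qed

text \<open>Interpolation makes \<open>xstar\<close> a common minimizer of all \<open>f i\<close>.
  Each envelope agrees with \<open>f i\<close> there and never falls below that minimum, so the
  average is minimal at \<open>xstar\<close> too.\<close>

lemma avg_moreau_min:
  "avg_fun n (\<lambda>i. moreau \<gamma> (f i)) xstar \<le> avg_fun n (\<lambda>i. moreau \<gamma> (f i)) y"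
proof (rule avg_fun_le)
  fix i assume "i \<in> {1..n}"
  then show "moreau \<gamma> (f i) xstar \<le> moreau \<gamma> (f i) y"
    using moreau_at_minimum[OF f_convex \<gamma> f_min] moreau_ge[OF f_convex \<gamma> f_min] by metis
qed

lemma norm_ubar_bound: "(norm (ubar x))\<^sup>2 \<le> L\<gamma> * (ubar x \<bullet> (x - xstar))"
  using smooth_min_subgradient_bounds(2)[OF L\<gamma>_smooth L\<gamma>_pos avg_moreau_min
      avg_moreau_subgradient, of x]
  by (simp add: L\<gamma>_pos divide_le_eq mult.commute)

lemma avg_norm_u_bound:
  "1 / real n * (\<Sum>i\<in>{1..n}. (norm (u i x))\<^sup>2)
     \<le> Lmax / (1 + \<gamma> * Lmax) * (ubar x \<bullet> (x - xstar))"
proof -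
  have "(norm (u i x))\<^sup>2 \<le> Lmax / (1 + \<gamma> * Lmax) * (u i x \<bullet> (x - xstar))"
    if i: "i \<in> {1..n}" for i
  proof -
    have le: "(norm (u i x))\<^sup>2 \<le> L i / (1 + \<gamma> * L i) * (u i x \<bullet> (x - xstar))"
      by (rule prox_displacement_bound[OF f_convex \<gamma> f_min f_smooth L_pos])
        (use i in \<open>auto simp: u_def\<close>)
    moreover have "0 < L i / (1 + \<gamma> * L i)"
      using L_pos[OF i] \<gamma> by (simp add: add_pos_pos)
    \<comment> \<open>The sign is what permits replacing the factor for \<open>L i\<close> by the
      larger one for \<open>Lmax\<close>.\<close>
    ultimately have "0 \<le> u i x \<bullet> (x - xstar)"
      by (smt (verit) zero_le_power2 mult_pos_neg)
    then have "L i / (1 + \<gamma> * L i) * (u i x \<bullet> (x - xstar))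
      \<le> Lmax / (1 + \<gamma> * Lmax) * (u i x \<bullet> (x - xstar))"
      using frac_one_plus_mono[OF L_pos Lmax \<gamma>] i by (intro mult_right_mono) auto
    with le show ?thesis by simp
  qed
  then have "1 / real n * (\<Sum>i\<in>{1..n}. (norm (u i x))\<^sup>2)
    \<le> 1 / real n * (\<Sum>i\<in>{1..n}. Lmax / (1 + \<gamma> * Lmax) * (u i x \<bullet> (x - xstar)))"
    by (intro mult_left_mono sum_mono) auto
  then show ?thesis
    by (simp only: ubar_inner sum_distrib_left[symmetric] mult.left_commute[of "1 / real n"])
qed

text \<open>A chain of gaps between \<open>x\<close> and \<open>xstar\<close>: strong convexity
  bounds the gap of the average of the \<open>f i\<close> from below, the envelope gap dominates it
  up to \<open>1 + \<gamma> * Lmax\<close>, and the subgradient \<open>ubar x\<close> bounds the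
  envelope gap from above.\<close>

lemma ubar_inner_lower_bound:
  "\<mu> / (2 * (1 + \<gamma> * Lmax)) * (norm (x - xstar))\<^sup>2 \<le> ubar x \<bullet> (x - xstar)"
proof -
  have diff: "avg_fun n f differentiable (at xstar)"
    using f_strong by (simp add: strongly_convex_def)
  have "avg_fun n f y \<ge> avg_fun n f xstar + 0 \<bullet> (y - xstar)" for y
    using avg_fun_le[of f xstar f y] f_min by simp
  then have "grad (avg_fun n f) xstar = 0"
    using diff by (intro grad_eq_subgradient)
  then have "\<mu> / 2 * (norm (x - xstar))\<^sup>2 \<le> avg_fun n f x - avg_fun n f xstar"
    using f_strong unfolding strongly_convex_def by (metis diff_zero inner_zero_left)
  then have "\<mu> / 2 * (norm (x - xstar))\<^sup>2 / (1 + \<gamma> * Lmax)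
      \<le> (avg_fun n f x - avg_fun n f xstar) / (1 + \<gamma> * Lmax)"
    using denom_pos by (intro divide_right_mono) auto
  also have "\<dots> = 1 / real n * (\<Sum>i\<in>{1..n}. (f i x - f i xstar) / (1 + \<gamma> * Lmax))"
    by (simp add: avg_fun_def sum_subtractf sum_divide_distrib[symmetric] right_diff_distrib
      diff_divide_distrib)
  also have "\<dots> \<le> 1 / real n * (\<Sum>i\<in>{1..n}. moreau \<gamma> (f i) x - moreau \<gamma> (f i) xstar)"
  proof (intro mult_left_mono sum_mono)
    fix i assume i: "i \<in> {1..n}"
    have "(f i x - f i xstar) / (1 + \<gamma> * Lmax) \<le> (f i x - f i xstar) / (1 + \<gamma> * L i)"
      using f_min[OF i, of x] L_pos[OF i] Lmax[OF i] \<gamma>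
      by (intro divide_left_mono) (auto simp: add_pos_pos denom_pos intro: mult_left_mono)
    also have "\<dots> \<le> moreau \<gamma> (f i) x - moreau \<gamma> (f i) xstar"
      by (rule moreau_gap_lower_bound[OF f_convex \<gamma> f_min f_smooth L_pos]) (use i in auto)
    finally show "(f i x - f i xstar) / (1 + \<gamma> * Lmax)
      \<le> moreau \<gamma> (f i) x - moreau \<gamma> (f i) xstar" .
  qed auto
  also have "\<dots> = avg_fun n (\<lambda>i. moreau \<gamma> (f i)) x - avg_fun n (\<lambda>i. moreau \<gamma> (f i)) xstar"
    by (simp add: avg_fun_def sum_subtractf right_diff_distrib)
  also have "\<dots> \<le> ubar x \<bullet> (x - xstar)"
    using avg_moreau_subgradient[of x xstar] by (simp add: inner_diff_right)
  finally show ?thesis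
    by simp
qed

text \<open>\<open>c1\<close> and \<open>c2\<close> are the weights of the mean squared norm and of
  the squared norm of the mean in the second moment of a sample mean. The factors
  \<open>(real \<tau>)\<^sup>2\<close> and \<open>n choose \<tau>\<close> appear because sums are
  kept in place of means.\<close>

lemma mean_norm_sampled_u_bound:
  assumes \<tau>: "\<tau> \<in> {1..n}"
  defines "c1 \<equiv> (real n - real \<tau>) / (real \<tau> * (real n - 1))"
    and "c2 \<equiv> real n * (real \<tau> - 1) / (real \<tau> * (real n - 1))"
  shows "(\<Sum>A\<in>tau_subsets n \<tau>. (norm (\<Sum>i\<in>A. u i x))\<^sup>2)
    \<le> real (n choose \<tau>) * ((real \<tau>)\<^sup>2
       * ((c1 * (Lmax / (1 + \<gamma> * Lmax)) + c2 * L\<gamma>) * (ubar x \<bullet> (x - xstar))))"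
proof -
  have pos: "0 < real \<tau>" "1 \<le> real \<tau>" "real \<tau> \<le> real n" "0 < real n - 1"
    using n \<tau> by auto
  then have c: "0 \<le> c1" "0 \<le> c2"
    by (auto simp: c1_def c2_def)
  have "(\<Sum>i\<in>{1..n}. u i x) = real n *\<^sub>R ubar x"
    using n_pos by (simp add: ubar_def)
  then have sq: "(norm (\<Sum>i\<in>{1..n}. u i x))\<^sup>2 = (real n)\<^sup>2 * (norm (ubar x))\<^sup>2"
    by (simp add: power_mult_distrib)
  have "(\<Sum>A\<in>tau_subsets n \<tau>. (norm (\<Sum>i\<in>A. u i x))\<^sup>2)
    = real (n choose \<tau>) * ((real \<tau>)\<^sup>2 * (c1 * (1 / real n * (\<Sum>i\<in>{1..n}. (norm (u i x))\<^sup>2))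
        + c2 * (norm (ubar x))\<^sup>2))"
  proof -
    have "real \<tau> * (real n - real \<tau>) / (real n * (real n - 1)) = (real \<tau>)\<^sup>2 * c1 * (1 / real n)"
      "real \<tau> * (real \<tau> - 1) / (real n * (real n - 1)) * (real n)\<^sup>2 = (real \<tau>)\<^sup>2 * c2"
      using pos n_pos by (simp_all add: c1_def c2_def power2_eq_square)
    moreover have "(\<Sum>A\<in>tau_subsets n \<tau>. (norm (\<Sum>i\<in>A. u i x))\<^sup>2)
      = real (n choose \<tau>) * (real \<tau> * (real n - real \<tau>) / (real n * (real n - 1))
          * (\<Sum>i\<in>{1..n}. (norm (u i x))\<^sup>2)
        + real \<tau> * (real \<tau> - 1) / (real n * (real n - 1)) * (real n)\<^sup>2 * (norm (ubar x))\<^sup>2)"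
      using sum_tau_subsets_norm_sum[of \<tau> n "\<lambda>i. u i x"] \<tau> n
      by (simp only: sq mult.assoc atLeastAtMost_iff)
    ultimately show ?thesis
      by (simp only: distrib_left mult.assoc)
  qed
  also have "\<dots> \<le> real (n choose \<tau>) * ((real \<tau>)\<^sup>2
     * (c1 * (Lmax / (1 + \<gamma> * Lmax) * (ubar x \<bullet> (x - xstar))) + c2 * (L\<gamma> * (ubar x \<bullet> (x - xstar)))))"
    by (intro mult_left_mono add_mono avg_norm_u_bound norm_ubar_bound c) auto
  finally show ?thesis
    by (simp add: distrib_right mult.assoc)
qed

lemma fedexprox_step_contraction:
  assumes \<tau>: "\<tau> \<in> {1..n}"
  defines "L\<gamma>\<tau> \<equiv> (real n - real \<tau>) / (real \<tau> * (real n - 1)) * (Lmax / (1 + \<gamma> * Lmax))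
      + real n * (real \<tau> - 1) / (real \<tau> * (real n - 1)) * L\<gamma>"
  assumes \<alpha>: "0 < \<alpha>" "\<alpha> * \<gamma> * L\<gamma>\<tau> < 2"
  shows "(\<Sum>A\<in>tau_subsets n \<tau>.
        (norm (x + \<alpha> *\<^sub>R ((1 / real \<tau>) *\<^sub>R (\<Sum>i\<in>A. prox \<gamma> (f i) x) - x) - xstar))\<^sup>2)
      / card (tau_subsets n \<tau>)
    \<le> (1 - \<alpha> * \<gamma> * (2 - \<alpha> * \<gamma> * L\<gamma>\<tau>) * (\<mu> / (2 * (1 + \<gamma> * Lmax)))) * (norm (x - xstar))\<^sup>2"
proof -
  have \<tau>1: "1 \<le> \<tau>"
    using \<tau> by simp
  define N where "N = real (n choose \<tau>)"
  define q where "q = ubar x \<bullet> (x - xstar)"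
  \<comment> \<open>With this \<open>c\<close> the update subtracts \<open>c\<close> times the sum
    of the sampled \<open>u i x\<close>.\<close>
  define c where "c = \<alpha> * \<gamma> / real \<tau>"
  have N: "0 < N"
    using \<tau> by (simp add: N_def)
  have step: "(norm (x + \<alpha> *\<^sub>R ((1 / real \<tau>) *\<^sub>R (\<Sum>i\<in>A. prox \<gamma> (f i) x) - x) - xstar))\<^sup>2
    = (norm (x - xstar))\<^sup>2 - 2 * c * ((\<Sum>i\<in>A. u i x) \<bullet> (x - xstar))
      + c\<^sup>2 * (norm (\<Sum>i\<in>A. u i x))\<^sup>2" if A: "A \<in> tau_subsets n \<tau>" for A
  proof -
    have "(\<Sum>i\<in>A. prox \<gamma> (f i) x) = (\<Sum>i\<in>A. x - \<gamma> *\<^sub>R u i x)"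
      using \<gamma> by (simp add: u_def)
    also have "\<dots> = real \<tau> *\<^sub>R x - \<gamma> *\<^sub>R (\<Sum>i\<in>A. u i x)"
      using A by (simp add: sum_subtractf scaleR_right.sum tau_subsets_def sum_constant_scaleR)
    finally have "x + \<alpha> *\<^sub>R ((1 / real \<tau>) *\<^sub>R (\<Sum>i\<in>A. prox \<gamma> (f i) x) - x) - xstar
      = (x - xstar) - c *\<^sub>R (\<Sum>i\<in>A. u i x)"
      using \<tau>1 by (simp add: c_def scaleR_diff_right)
    moreover have "(norm (v - c *\<^sub>R w))\<^sup>2 = (norm v)\<^sup>2 - 2 * c * (w \<bullet> v) + c\<^sup>2 * (norm w)\<^sup>2" for v w :: 'a
      unfolding power2_norm_eq_inner
      by (simp add: inner_diff_left inner_diff_right inner_commute power2_eq_square)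
    ultimately show ?thesis
      by (simp only:)
  qed
  have "(\<Sum>A\<in>tau_subsets n \<tau>.
        (norm (x + \<alpha> *\<^sub>R ((1 / real \<tau>) *\<^sub>R (\<Sum>i\<in>A. prox \<gamma> (f i) x) - x) - xstar))\<^sup>2)
    = (\<Sum>A\<in>tau_subsets n \<tau>. (norm (x - xstar))\<^sup>2 - 2 * c * ((\<Sum>i\<in>A. u i x) \<bullet> (x - xstar))
      + c\<^sup>2 * (norm (\<Sum>i\<in>A. u i x))\<^sup>2)"
    using step by (intro sum.cong) auto
  also have "\<dots> = N * (norm (x - xstar))\<^sup>2
      - 2 * c * ((\<Sum>A\<in>tau_subsets n \<tau>. \<Sum>i\<in>A. u i x) \<bullet> (x - xstar))
      + c\<^sup>2 * (\<Sum>A\<in>tau_subsets n \<tau>. (norm (\<Sum>i\<in>A. u i x))\<^sup>2)"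
    by (simp add: sum.distrib sum_subtractf sum_distrib_left inner_sum_left
      card_tau_subsets N_def)
  also have "(\<Sum>A\<in>tau_subsets n \<tau>. \<Sum>i\<in>A. u i x) \<bullet> (x - xstar) = N * (real \<tau> * q)"
    unfolding sum_tau_subsets_sum[OF \<tau>1] by (simp add: N_def q_def ubar_def)
  also have "c\<^sup>2 * (\<Sum>A\<in>tau_subsets n \<tau>. (norm (\<Sum>i\<in>A. u i x))\<^sup>2)
    \<le> c\<^sup>2 * (N * ((real \<tau>)\<^sup>2 * (L\<gamma>\<tau> * q)))"
    unfolding N_def q_def L\<gamma>\<tau>_def
    by (intro mult_left_mono mean_norm_sampled_u_bound[OF \<tau>]) auto
  also have "N * (norm (x - xstar))\<^sup>2 - 2 * c * (N * (real \<tau> * q))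
      + c\<^sup>2 * (N * ((real \<tau>)\<^sup>2 * (L\<gamma>\<tau> * q)))
    = N * ((norm (x - xstar))\<^sup>2 - \<alpha> * \<gamma> * (2 - \<alpha> * \<gamma> * L\<gamma>\<tau>) * q)"
    using \<tau>1 by (simp add: c_def field_simps power2_eq_square)
  \<comment> \<open>Replacing \<open>q\<close> by its lower bound needs a nonnegative coefficient,
    which is where the upper limit on \<open>\<alpha>\<close> enters.\<close>
  also have "\<dots> \<le> N * ((norm (x - xstar))\<^sup>2 - \<alpha> * \<gamma> * (2 - \<alpha> * \<gamma> * L\<gamma>\<tau>)
      * (\<mu> / (2 * (1 + \<gamma> * Lmax)) * (norm (x - xstar))\<^sup>2))"
    unfolding q_def using \<alpha> \<gamma> N
    by (intro mult_left_mono diff_left_mono ubar_inner_lower_bound mult_nonneg_nonneg) auto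
  also have "\<dots> = (1 - \<alpha> * \<gamma> * (2 - \<alpha> * \<gamma> * L\<gamma>\<tau>) * (\<mu> / (2 * (1 + \<gamma> * Lmax))))
      * (norm (x - xstar))\<^sup>2 * N"
    by (simp only: left_diff_distrib mult_1_left mult.assoc mult.commute[of N])
  finally show ?thesis
    by (simp only: card_tau_subsets N_def[symmetric] pos_divide_le_eq[OF N])
qed

end

section \<open>The optimal extrapolation parameter and the convergence bounds\<close>

text \<open>Completing the square in \<open>\<alpha>\<close>: for positive \<open>m\<close> and
  \<open>l\<close> the excess over the value at \<open>1 / (c * l)\<close> is positive elsewhere, so
  the minimizer is unique.\<close>

lemma quadratic_rate_diff:
  fixes c :: real
  assumes "c \<noteq> 0" "l \<noteq> 0"
  shows "(1 - \<alpha> * c * (2 - \<alpha> * c * l) * m) - (1 - 1 / (c * l) * c * (2 - 1 / (c * l) * c * l) * m)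
    = m * l * c\<^sup>2 * (\<alpha> - 1 / (c * l))\<^sup>2"
  using assms by (simp add: field_simps power2_eq_square)

theorem corollary1:
  fixes f :: "nat \<Rightarrow> real ^ 'd \<Rightarrow> real"
    and L :: "nat \<Rightarrow> real"
    and n \<tau> :: nat
    and \<mu> \<gamma> L\<gamma> :: real
    and xstar x0 :: "real ^ 'd"
    and P :: "'w measure"
    and S :: "nat \<Rightarrow> 'w \<Rightarrow> nat set"
  defines "Lmax \<equiv> Max (L ` {1..n})"
  defines "L\<gamma>\<tau> \<equiv>
      (real n - real \<tau>) / (real \<tau> * (real n - 1)) * (Lmax / (1 + \<gamma> * Lmax))
      + real n * (real \<tau> - 1) / (real \<tau> * (real n - 1)) * L\<gamma>"
  defines "rate \<equiv> \<lambda>\<alpha>. 1 - \<alpha> * \<gamma> * (2 - \<alpha> * \<gamma> * L\<gamma>\<tau>) * (\<mu> / (2 * (1 + \<gamma> * Lmax)))"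
  defines "X \<equiv> \<lambda>\<alpha> k \<omega>. fedexprox f \<tau> \<gamma> (\<lambda>_. \<alpha>) x0 (\<lambda>j. S j \<omega>) k"
  assumes n: "n \<ge> 2"
    and \<tau>: "\<tau> \<in> {1..n}"
    and f_convex: "\<And>i. i \<in> {1..n} \<Longrightarrow> convex_on UNIV (f i)"
    and L_pos: "\<And>i. i \<in> {1..n} \<Longrightarrow> L i > 0"
    and f_smooth: "\<And>i. i \<in> {1..n} \<Longrightarrow> smooth_with (L i) (f i)"
    and \<mu>: "\<mu> > 0"
    and f_strong: "strongly_convex \<mu> (avg_fun n f)"
    and interpolation: "\<And>i. i \<in> {1..n} \<Longrightarrow> grad (f i) xstar = 0"
    and \<gamma>: "\<gamma> > 0"
    and L\<gamma>_pos: "L\<gamma> > 0"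
    and L\<gamma>_smooth: "smooth_with L\<gamma> (avg_fun n (\<lambda>i. moreau \<gamma> (f i)))"
    and L\<gamma>_le: "L\<gamma> \<le> 1 / real n * (\<Sum>i\<in>{1..n}. L i / (1 + \<gamma> * L i))"
    and P: "prob_space P"
    and sampling: "nice_sampling P n \<tau> S"
  shows
    "(\<forall>\<alpha> \<in> {0 <..< 2 / (\<gamma> * L\<gamma>\<tau>)}. \<forall>K.
        prob_space.expectation P (\<lambda>\<omega>. (norm (X \<alpha> K \<omega> - xstar))\<^sup>2)
          \<le> rate \<alpha> ^ K * (norm (x0 - xstar))\<^sup>2)
     \<and> {\<alpha>. is_arg_min rate (\<lambda>\<beta>. \<beta> \<in> {0 <..< 2 / (\<gamma> * L\<gamma>\<tau>)}) \<alpha>} = {1 / (\<gamma> * L\<gamma>\<tau>)}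
     \<and> 1 / (\<gamma> * L\<gamma>\<tau>) > 1
     \<and> (\<forall>K. prob_space.expectation P (\<lambda>\<omega>. (norm (X (1 / (\<gamma> * L\<gamma>\<tau>)) K \<omega> - xstar))\<^sup>2)
          \<le> (1 - \<mu> / (2 * L\<gamma>\<tau> * (1 + \<gamma> * Lmax))) ^ K * (norm (x0 - xstar))\<^sup>2)"
proof -
  have L_le: "L i \<le> Lmax" if "i \<in> {1..n}" for i
    using that by (simp add: Lmax_def)
  interpret fedexprox_interpolation f L n \<mu> \<gamma> L\<gamma> Lmax xstar
    by unfold_locales (fact assms L_le)+
  define b where "b = Lmax / (1 + \<gamma> * Lmax)"
  define c1 where "c1 = (real n - real \<tau>) / (real \<tau> * (real n - 1))"
  define c2 where "c2 = real n * (real \<tau> - 1) / (real \<tau> * (real n - 1))"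
  have L\<gamma>\<tau>: "L\<gamma>\<tau> = c1 * b + c2 * L\<gamma>"
    by (simp add: L\<gamma>\<tau>_def b_def c1_def c2_def)
  have pos: "0 < real \<tau>" "1 \<le> real \<tau>" "real \<tau> \<le> real n" "0 < real n - 1"
    using n \<tau> by auto
  then have c_nonneg: "0 \<le> c1" "0 \<le> c2"
    by (auto simp: c1_def c2_def)
  \<comment> \<open>The weights sum to 1, so \<open>L\<gamma>\<tau>\<close> is a convex combination
    of \<open>b\<close> and \<open>L\<gamma>\<close>: it is at least the smaller of them, hence
    positive, and at most \<open>b\<close>.\<close>
  have "c1 + c2 = (real n - real \<tau> + real n * (real \<tau> - 1)) / (real \<tau> * (real n - 1))"
    by (simp add: c1_def c2_def add_divide_distrib)
  also have "\<dots> = 1"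
    using pos by (simp add: field_simps)
  finally have c_sum: "c1 + c2 = 1" .
  have b_pos: "0 < b" and b_less: "\<gamma> * b < 1"
    using Lmax_pos denom_pos \<gamma> by (auto simp: b_def)
  \<comment> \<open>The convention on \<open>L\<gamma>\<close> bounds it by an average of terms,
    each at most \<open>b\<close> by monotonicity of \<open>t / (1 + \<gamma> * t)\<close>.\<close>
  have L\<gamma>_le_b: "L\<gamma> \<le> b"
  proof -
    have "L\<gamma> \<le> 1 / real n * (\<Sum>i\<in>{1..n}. b)"
      unfolding b_def
      by (rule order_trans[OF L\<gamma>_le])
        (intro mult_left_mono sum_mono frac_one_plus_mono L_pos L_le \<gamma>; simp)
    then show ?thesis
      using n_pos by simp
  qed
  have "min b L\<gamma> * (c1 + c2) \<le> L\<gamma>\<tau>"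
    unfolding L\<gamma>\<tau> distrib_left using c_nonneg
    by (intro add_mono) (auto simp: mult.commute[of "min b L\<gamma>"] intro: mult_left_mono)
  then have pos\<tau>: "0 < L\<gamma>\<tau>"
    using b_pos L\<gamma>_pos c_sum by (auto simp: min_def split: if_splits)
  have "L\<gamma>\<tau> \<le> (c1 + c2) * b"
    unfolding L\<gamma>\<tau> distrib_right using c_nonneg L\<gamma>_le_b by (intro add_left_mono mult_left_mono)
  then have "\<gamma> * L\<gamma>\<tau> \<le> \<gamma> * b"
    using c_sum \<gamma> by simp
  \<comment> \<open>This is the claim that the optimal parameter
    \<open>1 / (\<gamma> * L\<gamma>\<tau>)\<close> exceeds 1.\<close>
  with b_less have less1: "\<gamma> * L\<gamma>\<tau> < 1"
    by linarith
  let ?best = "1 / (\<gamma> * L\<gamma>\<tau>)"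
  define m where "m = \<mu> / (2 * (1 + \<gamma> * Lmax))"
  have m: "0 < m"
    using \<mu> denom_pos by (simp add: m_def)
  have best_mem: "?best \<in> {0 <..< 2 / (\<gamma> * L\<gamma>\<tau>)}"
    using \<gamma> pos\<tau> by (simp add: divide_strict_right_mono)
  have rate_best: "rate ?best = 1 - \<mu> / (2 * L\<gamma>\<tau> * (1 + \<gamma> * Lmax))"
    using \<gamma> pos\<tau> by (simp add: rate_def mult_ac)
  have rate_diff: "rate \<alpha> - rate ?best = m * L\<gamma>\<tau> * \<gamma>\<^sup>2 * (\<alpha> - ?best)\<^sup>2" for \<alpha>
    unfolding rate_def m_def[symmetric] using \<gamma> pos\<tau> by (intro quadratic_rate_diff) auto
  have less: "rate ?best < rate \<alpha>" if "\<alpha> \<noteq> ?best" for \<alpha>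
  proof -
    have "0 < m * L\<gamma>\<tau> * \<gamma>\<^sup>2 * (\<alpha> - ?best)\<^sup>2"
      using that m \<gamma> pos\<tau> by (intro mult_pos_pos) auto
    then show ?thesis
      using rate_diff[of \<alpha>] by linarith
  qed
  have argmin: "{\<alpha>. is_arg_min rate (\<lambda>\<beta>. \<beta> \<in> {0 <..< 2 / (\<gamma> * L\<gamma>\<tau>)}) \<alpha>} = {?best}"
  proof (intro set_eqI iffI; unfold mem_Collect_eq is_arg_min_linorder)
    fix \<alpha> assume "\<alpha> \<in> {0 <..< 2 / (\<gamma> * L\<gamma>\<tau>)}
      \<and> (\<forall>\<beta>. \<beta> \<in> {0 <..< 2 / (\<gamma> * L\<gamma>\<tau>)} \<longrightarrow> rate \<alpha> \<le> rate \<beta>)"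
    then have "rate \<alpha> \<le> rate ?best"
      using best_mem by blast
    then show "\<alpha> \<in> {?best}"
      using less[of \<alpha>] by force
  next
    fix \<alpha> assume "\<alpha> \<in> {?best}"
    moreover have "rate ?best \<le> rate \<beta>" for \<beta>
      using less[of \<beta>] by (cases "\<beta> = ?best") auto
    ultimately show "\<alpha> \<in> {0 <..< 2 / (\<gamma> * L\<gamma>\<tau>)}
        \<and> (\<forall>\<beta>. \<beta> \<in> {0 <..< 2 / (\<gamma> * L\<gamma>\<tau>)} \<longrightarrow> rate \<alpha> \<le> rate \<beta>)"
      using best_mem by blast
  qed
  have bound: "prob_space.expectation P (\<lambda>\<omega>. (norm (X \<alpha> K \<omega> - xstar))\<^sup>2)
      \<le> rate \<alpha> ^ K * (norm (x0 - xstar))\<^sup>2" if \<alpha>: "\<alpha> \<in> {0 <..< 2 / (\<gamma> * L\<gamma>\<tau>)}" for \<alpha> K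
  proof -
    define step where
      "step A x = x + \<alpha> *\<^sub>R ((1 / real \<tau>) *\<^sub>R (\<Sum>i\<in>A. prox \<gamma> (f i) x) - x)" for A x
    have \<alpha>': "0 < \<alpha>" "\<alpha> * \<gamma> * L\<gamma>\<tau> < 2"
      using \<alpha> \<gamma> pos\<tau> by (auto simp: field_simps)
    have contr: "(\<Sum>A\<in>tau_subsets n \<tau>. (norm (step A x - xstar))\<^sup>2) / card (tau_subsets n \<tau>)
      \<le> rate \<alpha> * (norm (x - xstar))\<^sup>2" for x
      using fedexprox_step_contraction[OF \<tau> \<alpha>'(1), of x] \<alpha>'(2)
      by (simp add: step_def rate_def L\<gamma>\<tau>_def)
    \<comment> \<open>A single step from a point other than \<open>xstar\<close> shows that the rate is nonnegative, which
      is needed to iterate the contraction.\<close>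
    define x1 where "x1 = xstar + axis undefined 1"
    have x1: "x1 \<noteq> xstar"
      by (simp add: x1_def axis_eq_0_iff)
    have "0 \<le> (\<Sum>A\<in>tau_subsets n \<tau>. (norm (step A x1 - xstar))\<^sup>2) / card (tau_subsets n \<tau>)"
      by (intro divide_nonneg_nonneg sum_nonneg) auto
    then have "0 \<le> rate \<alpha> * (norm (x1 - xstar))\<^sup>2"
      using contr by (rule order_trans)
    then have rate_nonneg: "0 \<le> rate \<alpha>"
      using x1 by (simp add: zero_le_mult_iff)
    show ?thesis
      unfolding X_def
    proof (rule iid_uniform_contraction[where Z = "fedexprox f \<tau> \<gamma> (\<lambda>_. \<alpha>) x0" and step = step
          and V = "\<lambda>x. (norm (x - xstar))\<^sup>2" and T = "tau_subsets n \<tau>"])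
      show "tau_subsets n \<tau> \<noteq> {}"
        using \<tau> by (intro tau_subsets_nonempty) simp
    qed (use sampling in \<open>auto simp: P finite_tau_subsets nice_sampling_def step_def Let_def
        rate_nonneg contr[unfolded step_def]\<close>)
  qed
  show ?thesis
    using bound bound[OF best_mem] argmin less1 \<gamma> pos\<tau> by (simp add: rate_best)
qed

end
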